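(* For each $n$ let $T_n$ be a random partition of $[n]$, let $p_n,q_n\in[0,1]$, and let $G_n\sim\mathrm{PPM}(T_n,p_n,q_n)$. Assume: (i) $n^2\,\mathbb{E}[S_n^2]\,q_n^3p_n^2=o(1)$ and $q_n=o(n^{-4/5})$; (ii) there is a sequence $s_n^{(\min)}\to\infty$ such that $\mathbb{P}\big(\exists i\in[n]:\ 1<|T_n(i)|<s_n^{(\min)}\big)\to0$; (iii) for this sequence, $$p_n=\sqrt{\frac{\log\mathbb{E}[m_{T_n}]+\log\log\mathbb{E}[m_{T_n}]+\omega_n}{s_n^{(\min)}}}$$ for some sequence $\omega_n\to\infty$ (in particular $\mathbb{E}[m_{T_n}]>1$, so that the expression is defined). Then Diamond Percolation achieves exact recovery, i.e. $\mathbb{P}\big(\rho(\mathcal{D}(G_n),T_n)=1\big)\to1$ as $n\to\infty$.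
   Context: Asymptotics are as $n\to\infty$; $[n]=\{1,\dots,n\}$. For a partition $T$ of $[n]$, $i\stackrel{T}{\sim}j$ means $i,j$ are in the same block (community), $T(i)$ is the block containing $i$, and $m_T=\#\{1\le i<j\le n: i\stackrel{T}{\sim}j\}$. $S_n=|T_n(I_n)|$ where $I_n$ is uniform on $[n]$, independent of $T_n$ (expectations of $S_n$ are over both $T_n$ and $I_n$). Planted partition model: $G_n\sim\mathrm{PPM}(T_n,p_n,q_n)$ is the random simple undirected graph on $[n]$ in which, conditionally on $T_n$, each pair $ij$ is an edge independently with probability $p_n$ if $i\stackrel{T_n}{\sim}j$ and $q_n$ otherwise. Diamond Percolation $\mathcal{D}$: given a graph $G$ on $[n]$, let $G^*$ be the graph on $[n]$ whose edges are those edges $ij$ of $G$ such that $i$ and $j$ have at least two common neighbors in $G$. The output $\mathcal{D}(G)$ is the partition of $[n]$ into connected components of $G^*$. Correlation: with $N=\binom n2$ and $m_{CT}=\#\{i<j: i\stackrel{C}{\sim}j\text{ and }i\stackrel{T}{\sim}j\}$, $$\rho(C,T)=\frac{m_{CT}N-m_Cm_T}{\sqrt{m_C(N-m_C)m_T(N-m_T)}}.$$ If the denominator vanishes, set $\rho(C,T)=1$ if $C=T$, $\rho(C,T)=-1$ if one of $C,T$ is the single-block partition and the other is the all-singletons partition with $n\ge2$, and $\rho(C,T)=0$ otherwise. One has $\rho(C,T)=1$ iff $C=T$. *)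

theory Defs
  imports "HOL-Probability.Probability" "HOL-Library.Disjoint_Sets" "HOL-Library.Landau_Symbols"
begin

text \<open>A partition of \<open>[n]\<close> is a set of blocks \<open>P\<close> with \<^term>\<open>partition_on {1..n} P\<close>. A simple
  undirected graph on \<open>[n]\<close> is given by its set of edges, each a two-element set \<open>{i, j}\<close>.\<close>

definition same_block :: "nat set set \<Rightarrow> nat \<Rightarrow> nat \<Rightarrow> bool" where
  "same_block P i j \<longleftrightarrow> (\<exists>B\<in>P. i \<in> B \<and> j \<in> B)"

definition block :: "nat set set \<Rightarrow> nat \<Rightarrow> nat set" where
  "block P i = (THE B. B \<in> P \<and> i \<in> B)"

definition pairs :: "nat \<Rightarrow> (nat \<times> nat) set" where
  "pairs n = {(i, j). 1 \<le> i \<and> i < j \<and> j \<le> n}"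

definition num_intra :: "nat \<Rightarrow> nat set set \<Rightarrow> nat" where
  "num_intra n P = card {(i, j) \<in> pairs n. same_block P i j}"

definition num_common_intra :: "nat \<Rightarrow> nat set set \<Rightarrow> nat set set \<Rightarrow> nat" where
  "num_common_intra n C P = card {(i, j) \<in> pairs n. same_block C i j \<and> same_block P i j}"

definition single_block :: "nat \<Rightarrow> nat set set" where
  "single_block n = {{1..n}}"

definition all_singletons :: "nat \<Rightarrow> nat set set" where
  "all_singletons n = (\<lambda>i. {i}) ` {1..n}"

definition rho :: "nat \<Rightarrow> nat set set \<Rightarrow> nat set set \<Rightarrow> real" where
  "rho n C P =
    (let N = real (n choose 2);
         mC = real (num_intra n C);
         mP = real (num_intra n P);
         mCP = real (num_common_intra n C P);
         d = sqrt (mC * (N - mC) * mP * (N - mP))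
     in if d \<noteq> 0 then (mCP * N - mC * mP) / d
        else if C = P then 1
        else if n \<ge> 2 \<and> (C = single_block n \<and> P = all_singletons n \<or>
                         C = all_singletons n \<and> P = single_block n) then - 1
        else 0)"

definition common_neighbors :: "nat \<Rightarrow> nat set set \<Rightarrow> nat \<Rightarrow> nat \<Rightarrow> nat set" where
  "common_neighbors n G i j = {k \<in> {1..n}. {i, k} \<in> G \<and> {j, k} \<in> G}"

definition diamond_edges :: "nat \<Rightarrow> nat set set \<Rightarrow> nat set set" where
  "diamond_edges n G = {{i, j} | i j. {i, j} \<in> G \<and> card (common_neighbors n G i j) \<ge> 2}"

definition components :: "nat \<Rightarrow> nat set set \<Rightarrow> nat set set" where
  "components n G = {1..n} // {(i, j) \<in> {1..n} \<times> {1..n}. (i, j) \<in> {(u, v). {u, v} \<in> G}\<^sup>*}"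

definition diamond_percolation :: "nat \<Rightarrow> nat set set \<Rightarrow> nat set set" where
  "diamond_percolation n G = components n (diamond_edges n G)"

text \<open>The law of the planted partition graph, given that the partition equals \<open>P\<close>.\<close>

definition ppm_given :: "nat \<Rightarrow> nat set set \<Rightarrow> real \<Rightarrow> real \<Rightarrow> nat set set pmf" where
  "ppm_given n P p q =
    map_pmf (\<lambda>f. {{i, j} | i j. (i, j) \<in> pairs n \<and> f (i, j)})
      (Pi_pmf (pairs n) False (\<lambda>(i, j). bernoulli_pmf (if same_block P i j then p else q)))"

text \<open>The joint law of the random partition, distributed according to \<open>T\<close>, and the graph.\<close>

definition ppm :: "nat \<Rightarrow> nat set set pmf \<Rightarrow> real \<Rightarrow> real \<Rightarrow> (nat set set \<times> nat set set) pmf" where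
  "ppm n T p q = bind_pmf T (\<lambda>P. map_pmf (\<lambda>G. (P, G)) (ppm_given n P p q))"

text \<open>The law of the size of the community of an independent uniform vertex. It is meaningful for
  \<open>n \<ge> 1\<close> only, since \<^const>\<open>pmf_of_set\<close> is unspecified on the empty set.\<close>

definition block_size_pmf :: "nat \<Rightarrow> nat set set pmf \<Rightarrow> nat pmf" where
  "block_size_pmf n T = map_pmf (\<lambda>(P, i). card (block P i)) (pair_pmf T (pmf_of_set {1..n}))"

end

theory Submission imports Defs begin

text \<open>Diamond Percolation returns the partition \<open>P\<close> as soon as two things hold: no edge between
  different blocks has two common neighbors, and any two vertices of one block have at least two
  common neighbors inside that block (\<open>diamond_percolation_eqI\<close>). The first keeps all edges of \<open>G\<^sup>*\<close>
  inside blocks. The second puts every edge inside a block into \<open>G\<^sup>*\<close>, and since any two vertices of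
  a block then have a common neighbor there, it also joins them by a path of length two in \<open>G\<^sup>*\<close>.

  Fix \<open>P\<close>. For the first condition, take \<open>i\<close> and \<open>j\<close> in different blocks. The edge \<open>ij\<close> and two common
  neighbors use five different edges, so the failure probability at \<open>ij\<close> is at most \<open>q\<close> times the
  square of the sum over \<open>k\<close> of the probability that \<open>k\<close> is a common neighbor. That sum is at most
  \<open>n q\<^sup>2 + (|P(i)| + |P(j)|) p q\<close>, because \<open>k\<close> lies in the block of at most one of \<open>i\<close> and \<open>j\<close>.
  Summed over the pairs and averaged over \<open>P\<close>, this gives the order \<open>n\<^sup>4 q\<^sup>5 + n\<^sup>2 E[S\<^sup>2] q\<^sup>3 p\<^sup>2\<close>, and the
  two parts of hypothesis (i) say exactly that both terms vanish.

  For the second condition, two vertices of a block of size \<open>b\<close> have a binomial number of common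
  neighbors there, with parameters \<open>b - 2\<close> and \<open>p\<^sup>2\<close>. It is less than two with probability at most a
  constant times \<open>(1 + x) exp (- x)\<close>, where \<open>x = b p\<^sup>2\<close>. This decreases in \<open>x\<close>, so up to the vanishing
  probability in (ii) one may take \<open>b = s\<close>, and then \<open>x = ln m + ln (ln m) + \<omega>\<close> with
  \<open>m = E[m\<^sub>T]\<close>. The expected number of bad pairs is thus of order
  \<open>m (1 + x) exp (- x) = (1 + x) exp (- \<omega>) / ln m\<close>, which tends to \<open>0\<close> as long as \<open>ln m\<close> stays away
  from \<open>0\<close>. Nothing forces it to: \<open>m\<close> may be close to \<open>1\<close> if \<open>P\<close> consists of singletons with high
  probability. But for bounded \<open>m\<close> there is most likely nothing to recover: a block of size at
  least \<open>s\<close> contributes at least \<open>s - 1\<close> pairs, so by Markov's inequality one exists with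
  probability at most \<open>m / (s - 1)\<close>. The lemma \<open>large_blocks_failure_bound\<close> combines these estimates
  for a single \<open>n\<close>.\<close>

section \<open>Partitions, graphs and Diamond Percolation\<close>

lemma block_eq:
  assumes "partition_on A P" "B \<in> P" "i \<in> B"
  shows "block P i = B"
  unfolding block_def using assms
  by (intro the_equality) (auto simp: partition_on_def disjoint_def)

lemma block_in_partition:
  assumes "partition_on A P" "i \<in> A"
  shows "block P i \<in> P" "i \<in> block P i"
proof -
  obtain B where "B \<in> P" "i \<in> B"
    using assms by (auto simp: partition_on_def)
  then show "block P i \<in> P" "i \<in> block P i"
    using block_eq[OF assms(1)] by auto
qed

lemma block_subset:
  assumes "partition_on A P" "i \<in> A"
  shows "block P i \<subseteq> A"
  using block_in_partition[OF assms] assms(1) by (auto simp: partition_on_def)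

lemma same_block_iff:
  assumes "partition_on A P" "i \<in> A"
  shows "same_block P i j \<longleftrightarrow> j \<in> block P i"
proof
  assume "same_block P i j"
  then obtain B where B: "B \<in> P" "i \<in> B" "j \<in> B" by (auto simp: same_block_def)
  then show "j \<in> block P i" using block_eq[OF assms(1) B(1,2)] by simp
next
  assume "j \<in> block P i"
  then show "same_block P i j"
    unfolding same_block_def using block_in_partition[OF assms] by blast
qed

lemma same_block_sym: "same_block P i j \<longleftrightarrow> same_block P j i"
  by (auto simp: same_block_def)

lemma same_block_trans:
  assumes "partition_on A P" "same_block P i j" "same_block P j k"
  shows "same_block P i k"
proof -
  obtain B C where B: "B \<in> P" "i \<in> B" "j \<in> B" and C: "C \<in> P" "j \<in> C" "k \<in> C"
    using assms(2,3) by (auto simp: same_block_def)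
  have "B = C"
    using block_eq[OF assms(1) B(1,3)] block_eq[OF assms(1) C(1,2)] by simp
  then show ?thesis using B C by (auto simp: same_block_def)
qed

lemma same_block_refl: "partition_on A P \<Longrightarrow> i \<in> A \<Longrightarrow> same_block P i i"
  by (auto simp: same_block_def partition_on_def)

lemma finite_pairs [simp]: "finite (pairs n)"
  by (rule finite_subset[of _ "{1..n} \<times> {1..n}"]) (auto simp: pairs_def)

lemma num_intra_le: "num_intra n P \<le> n choose 2"
proof -
  let ?S = "{A. A \<subseteq> {1..n} \<and> card A = 2}"
  have "num_intra n P \<le> card (pairs n)"
    unfolding num_intra_def by (intro card_mono) auto
  also have "\<dots> \<le> card ?S"
  proof (rule card_inj_on_le)
    show "inj_on (\<lambda>(i, j). {i, j}) (pairs n)"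
      by (auto simp: inj_on_def pairs_def doubleton_eq_iff)
    show "(\<lambda>(i, j). {i, j}) ` pairs n \<subseteq> ?S"
      by (auto simp: pairs_def)
    show "finite ?S"
      by (rule finite_subset[of _ "Pow {1..n}"]) auto
  qed
  also have "\<dots> = n choose 2"
    using n_subsets[of "{1..n}" 2] by simp
  finally show ?thesis .
qed

text \<open>Because \<open>m \<le> N\<close>, the square root in the denominator is \<open>m (N - m)\<close>, which is also the numerator.
  Where it vanishes, the definition assigns the value \<open>1\<close> to equal arguments.\<close>

lemma rho_self: "rho n P P = 1"
proof -
  define m N where "m = real (num_intra n P)" and "N = real (n choose 2)"
  have eq: "num_common_intra n P P = num_intra n P"
    by (simp add: num_common_intra_def num_intra_def)
  have le: "m \<le> N" "0 \<le> m"
    using num_intra_le[of n P] by (simp_all add: m_def N_def)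
  have "m * (N - m) * m * (N - m) = (m * (N - m)) ^ 2"
    by (simp add: power2_eq_square algebra_simps)
  then have "sqrt (m * (N - m) * m * (N - m)) = m * (N - m)"
    using le by simp
  then show ?thesis
    unfolding rho_def Let_def eq m_def[symmetric] N_def[symmetric]
    by (simp add: algebra_simps)
qed

text \<open>Diamond edges stay inside blocks by \<open>inter\<close>, so components refine \<open>P\<close>. Conversely, \<open>intra\<close> is asked
  for all pairs of a block, adjacent or not: for adjacent ones it yields diamond edges, and for
  arbitrary ones a common neighbor through which two such edges connect them.\<close>

lemma diamond_percolation_eqI:
  assumes P: "partition_on {1..n} P"
    and edges: "\<And>e. e \<in> G \<Longrightarrow> \<exists>i j. (i, j) \<in> pairs n \<and> e = {i, j}"
    and inter: "\<And>i j. i \<in> {1..n} \<Longrightarrow> j \<in> {1..n} \<Longrightarrow> \<not> same_block P i j \<Longrightarrow> {i, j} \<in> G \<Longrightarrow>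
      card (common_neighbors n G i j) < 2"
    and intra: "\<And>i j. i \<in> {1..n} \<Longrightarrow> j \<in> {1..n} \<Longrightarrow> i \<noteq> j \<Longrightarrow> same_block P i j \<Longrightarrow>
      2 \<le> card (common_neighbors n G i j \<inter> block P i)"
  shows "diamond_percolation n G = P"
proof -
  let ?E = "{(u, v). {u, v} \<in> diamond_edges n G}"
  let ?R = "{(i, j) \<in> {1..n} \<times> {1..n}. (i, j) \<in> ?E\<^sup>*}"
  have comm: "common_neighbors n G i j = common_neighbors n G j i" for i j
    by (auto simp: common_neighbors_def)
  have edgeD: "{i, j} \<in> G \<and> 2 \<le> card (common_neighbors n G i j)"
    if "{i, j} \<in> diamond_edges n G" for i j
    using that comm by (auto simp: diamond_edges_def doubleton_eq_iff insert_commute)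
  have verts: "i \<in> {1..n} \<and> j \<in> {1..n} \<and> i \<noteq> j" if "{i, j} \<in> G" for i j
    using edges[OF that] by (auto simp: pairs_def doubleton_eq_iff)
  have within: "same_block P i j" if "{i, j} \<in> diamond_edges n G" for i j
    using edgeD[OF that] inter[of i j] verts[of i j] by fastforce
  have path: "same_block P i j" if "(i, j) \<in> ?E\<^sup>*" "i \<in> {1..n}" for i j
    using that(1)
  proof (induction rule: rtrancl_induct)
    case base
    show ?case using same_block_refl[OF P that(2)] .
  next
    case (step y z)
    then show ?case using within same_block_trans[OF P] by auto
  qed
  have close: "{i, k} \<in> diamond_edges n G"
    if "i \<in> {1..n}" "k \<in> block P i" "{i, k} \<in> G" for i k
  proof -
    have k: "k \<in> {1..n}" "i \<noteq> k" using verts[OF that(3)] by auto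
    have "2 \<le> card (common_neighbors n G i k \<inter> block P i)"
      using intra[of i k] that k same_block_iff[OF P that(1)] by auto
    also have "\<dots> \<le> card (common_neighbors n G i k)"
      by (intro card_mono) (auto simp: common_neighbors_def)
    finally show ?thesis using that(3) by (auto simp: diamond_edges_def)
  qed
  have conv: "(i, j) \<in> ?E\<^sup>*" if ij: "i \<in> {1..n}" "j \<in> {1..n}" "same_block P i j" for i j
  proof (cases "i = j")
    case False
    have "2 \<le> card (common_neighbors n G i j \<inter> block P i)"
      using intra ij False by blast
    then have "common_neighbors n G i j \<inter> block P i \<noteq> {}"
      by (intro notI) simp
    then obtain k where k: "k \<in> block P i" "{i, k} \<in> G" "{j, k} \<in> G"
      by (auto simp: common_neighbors_def)
    have "same_block P i k" using k(1) same_block_iff[OF P ij(1)] by simp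
    then have "k \<in> block P j"
      using ij(3) same_block_trans[OF P] same_block_sym same_block_iff[OF P ij(2)] by blast
    then have "{i, k} \<in> diamond_edges n G" "{j, k} \<in> diamond_edges n G"
      using close k ij by auto
    then have "(i, k) \<in> ?E" "(k, j) \<in> ?E" by (auto simp: insert_commute)
    then show ?thesis by (meson rtrancl.rtrancl_refl rtrancl.rtrancl_into_rtrancl)
  qed simp
  have verts': "i \<in> {1..n} \<and> j \<in> {1..n}" if "same_block P i j" for i j
    using that P by (auto simp: same_block_def partition_on_def)
  have "?R = {(x, y). same_block P x y}"
  proof (intro set_eqI iffI)
    fix e assume "e \<in> ?R"
    then show "e \<in> {(x, y). same_block P x y}" using path by (cases e) blast
  next
    fix e assume "e \<in> {(x, y). same_block P x y}"
    then show "e \<in> ?R" using conv verts' by (cases e) blast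
  qed
  then have R: "?R = {(x, y). \<exists>p \<in> P. x \<in> p \<and> y \<in> p}"
    unfolding same_block_def .
  show ?thesis
    unfolding diamond_percolation_def components_def R
    by (rule partition_on_eq_quotient[OF P])
qed

section \<open>Independent edges\<close>

text \<open>The model has one coin for each pair \<open>(i, j)\<close> with \<open>i < j\<close>. Addressing the coin of an unordered
  pair by its sorted representative lets vertices be handled without regard to their order.\<close>

definition edge :: "nat \<Rightarrow> nat \<Rightarrow> nat \<times> nat" where
  "edge i j = (min i j, max i j)"

definition graph_of :: "nat \<Rightarrow> (nat \<times> nat \<Rightarrow> bool) \<Rightarrow> nat set set" where
  "graph_of n f = {{i, j} | i j. (i, j) \<in> pairs n \<and> f (i, j)}"

definition edge_prob :: "nat set set \<Rightarrow> real \<Rightarrow> real \<Rightarrow> nat \<times> nat \<Rightarrow> real" where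
  "edge_prob P p q = (\<lambda>(i, j). if same_block P i j then p else q)"

definition edge_indicators ::
    "nat \<Rightarrow> nat set set \<Rightarrow> real \<Rightarrow> real \<Rightarrow> (nat \<times> nat \<Rightarrow> bool) pmf" where
  "edge_indicators n P p q =
    Pi_pmf (pairs n) False (\<lambda>e. bernoulli_pmf (edge_prob P p q e))"

lemma ppm_given_eq: "ppm_given n P p q = map_pmf (graph_of n) (edge_indicators n P p q)"
  by (simp add: ppm_given_def graph_of_def[abs_def] edge_indicators_def edge_prob_def
      case_prod_unfold)

lemma edge_in_pairs: "edge i j \<in> pairs n \<longleftrightarrow> i \<in> {1..n} \<and> j \<in> {1..n} \<and> i \<noteq> j"
  by (auto simp: edge_def pairs_def min_def max_def)

lemma edge_eq_iff: "edge i j = edge k l \<longleftrightarrow> i = k \<and> j = l \<or> i = l \<and> j = k"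
  by (auto simp: edge_def min_def max_def)

lemma edge_prob_edge: "edge_prob P p q (edge i j) = (if same_block P i j then p else q)"
  using same_block_sym[of P i j] by (auto simp: edge_def edge_prob_def min_def max_def)

lemma in_graph_of: "{i, j} \<in> graph_of n f \<longleftrightarrow> edge i j \<in> pairs n \<and> f (edge i j)"
proof
  assume "{i, j} \<in> graph_of n f"
  then obtain a b where ab: "{i, j} = {a, b}" "(a, b) \<in> pairs n" "f (a, b)"
    by (auto simp: graph_of_def)
  then have "(a, b) = edge i j"
    by (auto simp: doubleton_eq_iff edge_def pairs_def)
  then show "edge i j \<in> pairs n \<and> f (edge i j)" using ab by simp
next
  assume "edge i j \<in> pairs n \<and> f (edge i j)"
  moreover have "{i, j} = {min i j, max i j}" by (auto simp: min_def max_def)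
  ultimately show "{i, j} \<in> graph_of n f" by (auto simp: graph_of_def edge_def)
qed

lemma common_neighbors_graph_of:
  assumes "i \<in> {1..n}" "j \<in> {1..n}"
  shows "common_neighbors n (graph_of n f) i j =
    {k \<in> {1..n} - {i, j}. f (edge i k) \<and> f (edge j k)}"
  using assms by (auto simp: common_neighbors_def in_graph_of edge_in_pairs)

lemma prob_all_True:
  assumes "finite A" "E \<subseteq> A" "\<And>e. e \<in> E \<Longrightarrow> r e \<in> {0..1}"
  shows "measure_pmf.prob (Pi_pmf A d (\<lambda>e. bernoulli_pmf (r e))) {f. \<forall>e\<in>E. f e} = (\<Prod>e\<in>E. r e)"
proof -
  let ?B = "\<lambda>e. if e \<in> E then {True} else UNIV"
  have "{f. \<forall>e\<in>E. f e} = Pi A ?B"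
    using assms(2) by (auto simp: Pi_def split: if_splits)
  then have "measure_pmf.prob (Pi_pmf A d (\<lambda>e. bernoulli_pmf (r e))) {f. \<forall>e\<in>E. f e} =
      (\<Prod>e\<in>A. measure_pmf.prob (bernoulli_pmf (r e)) (?B e))"
    using measure_Pi_pmf_Pi[OF assms(1)] by simp
  also have "\<dots> = (\<Prod>e\<in>A. if e \<in> E then r e else 1)"
    using assms(3) by (intro prod.cong) (auto simp: measure_pmf_single)
  also have "\<dots> = (\<Prod>e\<in>E. r e)"
    using assms(1,2) by (simp add: prod.If_cases Int_absorb1)
  finally show ?thesis .
qed

lemma bernoulli_conj:
  assumes "p \<in> {0..1}"
  shows "bernoulli_pmf (p ^ 2) =
    bind_pmf (bernoulli_pmf p) (\<lambda>y. bind_pmf (bernoulli_pmf p) (\<lambda>z. return_pmf (y \<and> z)))"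
proof (rule pmf_eqI)
  fix b :: bool
  have "p ^ 2 \<le> 1" using assms by (simp add: power_le_one)
  then show "pmf (bernoulli_pmf (p ^ 2)) b = pmf (bind_pmf (bernoulli_pmf p)
      (\<lambda>y. bind_pmf (bernoulli_pmf p) (\<lambda>z. return_pmf (y \<and> z)))) b"
    using assms by (cases b) (auto simp: pmf_bind power2_eq_square algebra_simps measure_pmf_single)
qed

text \<open>Pairs of coins with disjoint supports are independent, so the events that both coins of a pair show
  \<open>True\<close> form a family of independent coins of bias \<open>p\<^sup>2\<close>. The induction over \<open>K\<close> splits off the two
  coordinates of one index at a time; the remaining coordinates of \<open>A\<close> must be allowed to vary
  with it.\<close>

lemma paired_coordinates_Pi_pmf:
  assumes "finite K" "p \<in> {0..1}" "finite A" "a ` K \<subseteq> A" "b ` K \<subseteq> A" "inj_on a K" "inj_on b K"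
    "a ` K \<inter> b ` K = {}" "\<And>k. k \<in> K \<Longrightarrow> D (a k) = bernoulli_pmf p"
    "\<And>k. k \<in> K \<Longrightarrow> D (b k) = bernoulli_pmf p"
  shows "map_pmf (\<lambda>f k. k \<in> K \<and> f (a k) \<and> f (b k)) (Pi_pmf A d D) =
    Pi_pmf K False (\<lambda>_. bernoulli_pmf (p ^ 2))"
  using assms
proof (induction K arbitrary: A rule: finite_induct)
  case empty
  then show ?case by (simp add: map_pmf_const)
next
  case (insert x K)
  define A' where "A' = A - {a x, b x}"
  let ?g = "\<lambda>f k. k \<in> K \<and> f (a k) \<and> f (b k)"
  have ab: "a x \<noteq> b x" using insert.prems by auto
  have ne: "a k \<noteq> a x" "b k \<noteq> b x" "a k \<noteq> b x" "b k \<noteq> a x" if "k \<in> K" for k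
  proof -
    have "k \<noteq> x" using that insert.hyps(2) by blast
    then show "a k \<noteq> a x" "b k \<noteq> b x"
      using that inj_on_eq_iff[OF insert.prems(5), of k x]
        inj_on_eq_iff[OF insert.prems(6), of k x] by simp_all
    show "a k \<noteq> b x" "b k \<noteq> a x" using that insert.prems(7) by blast+
  qed
  have A: "A = insert (a x) (insert (b x) A')"
    using insert.prems by (auto simp: A'_def)
  have A': "finite A'" "a x \<notin> insert (b x) A'" "b x \<notin> A'"
    using insert.prems ab by (auto simp: A'_def)
  have IH: "map_pmf ?g (Pi_pmf A' d D) = Pi_pmf K False (\<lambda>_. bernoulli_pmf (p ^ 2))"
  proof (rule insert.IH)
    show "inj_on a K" "inj_on b K" using insert.prems(5,6) by (auto intro: inj_on_subset)
    show "a ` K \<subseteq> A'" using insert.prems(3) ne by (auto simp: A'_def)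
    show "b ` K \<subseteq> A'" using insert.prems(4) ne by (auto simp: A'_def)
    show "a ` K \<inter> b ` K = {}" using insert.prems(7) by blast
    show "D (a k) = bernoulli_pmf p" "D (b k) = bernoulli_pmf p" if "k \<in> K" for k
      using insert.prems(8,9) that by blast+
  qed (use insert.prems A' in blast)+
  have D: "D (a x) = bernoulli_pmf p" "D (b x) = bernoulli_pmf p"
    using insert.prems by auto
  have upd: "(\<lambda>k. k \<in> insert x K \<and> (f(b x := z, a x := y)) (a k) \<and> (f(b x := z, a x := y)) (b k))
      = (?g f)(x := (y \<and> z))" for f y z
    using ne ab insert.hyps(2) by (intro ext) auto
  have "Pi_pmf A d D = bind_pmf (bernoulli_pmf p) (\<lambda>y. bind_pmf (bernoulli_pmf p)
      (\<lambda>z. bind_pmf (Pi_pmf A' d D) (\<lambda>f. return_pmf (f(b x := z, a x := y)))))"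
    unfolding A using A' by (simp add: Pi_pmf_insert' D bind_assoc_pmf bind_return_pmf)
  then have "map_pmf (\<lambda>f k. k \<in> insert x K \<and> f (a k) \<and> f (b k)) (Pi_pmf A d D) =
      bind_pmf (bernoulli_pmf p) (\<lambda>y. bind_pmf (bernoulli_pmf p)
      (\<lambda>z. bind_pmf (Pi_pmf A' d D) (\<lambda>f. return_pmf ((?g f)(x := (y \<and> z))))))"
    by (simp only: map_bind_pmf map_return_pmf upd)
  also have "\<dots> = bind_pmf (bernoulli_pmf (p ^ 2)) (\<lambda>w. bind_pmf (map_pmf ?g (Pi_pmf A' d D))
      (\<lambda>h. return_pmf (h(x := w))))"
    using insert.prems(1)
    by (simp add: bernoulli_conj bind_assoc_pmf bind_return_pmf bind_map_pmf)
  also have "\<dots> = Pi_pmf (insert x K) False (\<lambda>_. bernoulli_pmf (p ^ 2))"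
    using insert.hyps by (simp add: IH Pi_pmf_insert')
  finally show ?case .
qed

lemma card_paired_coordinates_binomial:
  assumes "finite K" "p \<in> {0..1}" "finite A" "a ` K \<subseteq> A" "b ` K \<subseteq> A" "inj_on a K" "inj_on b K"
    "a ` K \<inter> b ` K = {}" "\<And>k. k \<in> K \<Longrightarrow> D (a k) = bernoulli_pmf p"
    "\<And>k. k \<in> K \<Longrightarrow> D (b k) = bernoulli_pmf p"
  shows "map_pmf (\<lambda>f. card {k \<in> K. f (a k) \<and> f (b k)}) (Pi_pmf A d D) =
    binomial_pmf (card K) (p ^ 2)"
proof -
  have "binomial_pmf (card K) (p ^ 2) =
      map_pmf (\<lambda>f. card {k \<in> K. f k}) (Pi_pmf K False (\<lambda>_. bernoulli_pmf (p ^ 2)))"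
    using assms(1,2) by (intro binomial_pmf_altdef') (auto simp: power_le_one)
  also have "\<dots> = map_pmf (\<lambda>f. card {k \<in> K. f (a k) \<and> f (b k)}) (Pi_pmf A d D)"
    by (subst paired_coordinates_Pi_pmf[OF assms, symmetric])
      (auto simp: map_pmf_comp intro!: map_pmf_cong arg_cong[where f = card])
  finally show ?thesis by simp
qed

section \<open>Common neighbors of a pair of vertices\<close>

text \<open>With \<open>b = N + 2\<close> the size of a block, the bound is stated in the variable \<open>x = b r\<close>. Replacing
  \<open>(1 - r)^N\<close> and \<open>(1 - r)^(N - 1)\<close> by exponentials with \<open>b\<close> in the exponent loses at most \<open>exp (3 r)\<close>,
  since \<open>N - 1 = b - 3\<close>; this is the source of the factor \<open>exp 3\<close>.\<close>

lemma binomial_less_two: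
  assumes r: "r \<in> {0..1}"
  shows "measure_pmf.prob (binomial_pmf N r) {..<2} \<le>
    exp 3 * (1 + real (N + 2) * r) * exp (- (real (N + 2) * r))"
proof -
  have r01: "0 \<le> r" "r \<le> 1" using r by auto
  have e: "(1 - r) ^ k \<le> exp (- (real k * r))" for k
  proof -
    have "(1 - r) ^ k \<le> exp (- r) ^ k"
      using r01 exp_ge_add_one_self[of "- r"] by (intro power_mono) auto
    also have "\<dots> = exp (- (real k * r))" by (simp add: exp_of_nat_mult[symmetric])
    finally show ?thesis .
  qed
  have "{..<2::nat} = {0, 1}" by auto
  then have "measure_pmf.prob (binomial_pmf N r) {..<2} = (1 - r) ^ N + real N * r * (1 - r) ^ (N - 1)"
    using r by (simp add: measure_measure_pmf_finite)
  also have "\<dots> \<le> exp (- ((real N - 1) * r)) + real N * r * exp (- ((real N - 1) * r))"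
  proof (intro add_mono)
    have "(1 - r) ^ N \<le> exp (- (real N * r))" by (rule e)
    also have "\<dots> \<le> exp (- ((real N - 1) * r))" using r01 by (simp add: algebra_simps)
    finally show "(1 - r) ^ N \<le> exp (- ((real N - 1) * r))" .
    show "real N * r * (1 - r) ^ (N - 1) \<le> real N * r * exp (- ((real N - 1) * r))"
    proof (cases "N = 0")
      case False
      then show ?thesis using e[of "N - 1"] r01 by (intro mult_left_mono) (auto simp: of_nat_diff)
    qed simp
  qed
  also have "\<dots> = (1 + real N * r) * exp (3 * r) * exp (- (real (N + 2) * r))"
    by (simp add: algebra_simps exp_add[symmetric])
  also have "\<dots> \<le> (1 + real (N + 2) * r) * exp 3 * exp (- (real (N + 2) * r))"
    using r01 by (intro mult_right_mono mult_mono) (auto simp: algebra_simps)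
  finally show ?thesis by (simp add: algebra_simps)
qed

lemma few_common_neighbors_in_block:
  assumes P: "partition_on {1..n} P" and p: "p \<in> {0..1}"
    and ij: "i \<in> {1..n}" "j \<in> block P i" "i \<noteq> j"
  shows "measure_pmf.prob (edge_indicators n P p q)
      {f. card {k \<in> block P i - {i, j}. f (edge i k) \<and> f (edge j k)} < 2} \<le>
    exp 3 * (1 + real (card (block P i)) * p ^ 2) * exp (- (real (card (block P i)) * p ^ 2))"
proof -
  let ?K = "block P i - {i, j}"
  have sub: "block P i \<subseteq> {1..n}" using block_subset[OF P ij(1)] .
  have fin: "finite (block P i)" using sub finite_subset by blast
  have j: "j \<in> {1..n}" using sub ij by auto
  have same: "same_block P i k" "same_block P j k" if "k \<in> block P i" for k
  proof -
    show ik: "same_block P i k" using that same_block_iff[OF P ij(1)] by simp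
    have "same_block P i j" using ij(2) same_block_iff[OF P ij(1)] by simp
    then show "same_block P j k"
      using ik same_block_trans[OF P] same_block_sym by blast
  qed
  have ij2: "{i, j} \<subseteq> block P i" using ij block_in_partition[OF P ij(1)] by auto
  have card: "card ?K + 2 = card (block P i)"
    using ij2 fin ij(3) card_mono[OF fin ij2] by (simp add: card_Diff_subset)
  \<comment> \<open>The vertex \<open>k\<close> owns the two coins \<open>edge i k\<close> and \<open>edge j k\<close>, and no other vertex uses them.\<close>
  have law: "map_pmf (\<lambda>f. card {k \<in> ?K. f (edge i k) \<and> f (edge j k)}) (edge_indicators n P p q) =
      binomial_pmf (card ?K) (p ^ 2)"
    unfolding edge_indicators_def
    using fin p sub ij j same
    by (intro card_paired_coordinates_binomial)
      (auto simp: edge_in_pairs edge_eq_iff inj_on_def edge_prob_edge)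
  have "measure_pmf.prob (edge_indicators n P p q)
      {f. card {k \<in> ?K. f (edge i k) \<and> f (edge j k)} < 2} =
      measure_pmf.prob (binomial_pmf (card ?K) (p ^ 2)) {..<2}"
    unfolding law[symmetric] measure_map_pmf by (simp add: vimage_def)
  also have "\<dots> \<le> exp 3 * (1 + real (card ?K + 2) * p ^ 2) * exp (- (real (card ?K + 2) * p ^ 2))"
    using p by (intro binomial_less_two) (auto simp: power_le_one)
  finally show ?thesis unfolding card .
qed

lemma prob_UN_le:
  fixes M :: "'a pmf"
  assumes "finite I"
  shows "measure_pmf.prob M (\<Union>i\<in>I. X i) \<le> (\<Sum>i\<in>I. measure_pmf.prob M (X i))"
  using assms by (intro measure_pmf.finite_measure_subadditive_finite) auto

lemma square_sum3_le: "(x + y + z) ^ 2 \<le> 3 * (x ^ 2 + y ^ 2 + z ^ 2)" for x y z :: real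
proof -
  have "0 \<le> (x - y) ^ 2 + (y - z) ^ 2 + (x - z) ^ 2" by simp
  then show ?thesis by (simp add: power2_eq_square algebra_simps)
qed

text \<open>A union bound over ordered pairs \<open>k \<noteq> l\<close> of common neighbors: the five edges \<open>ij\<close>, \<open>ik\<close>, \<open>jk\<close>, \<open>il\<close>, \<open>jl\<close>
  are different, hence independent. The factor \<open>3\<close> comes from splitting the square of the sum of
  three terms, which avoids the mixed terms and leaves only quantities that the hypotheses of the
  theorem control.\<close>

lemma inter_edge_with_two_common_neighbors:
  assumes P: "partition_on {1..n} P" and p: "p \<in> {0..1}" and q: "q \<in> {0..1}"
    and ij: "i \<in> {1..n}" "j \<in> {1..n}" "\<not> same_block P i j"
  shows "measure_pmf.prob (edge_indicators n P p q)
      {f. f (edge i j) \<and> 2 \<le> card {k \<in> {1..n} - {i, j}. f (edge i k) \<and> f (edge j k)}} \<le>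
    3 * real n ^ 2 * q ^ 5
      + 3 * p ^ 2 * q ^ 3 * (real (card (block P i)) ^ 2 + real (card (block P j)) ^ 2)"
proof -
  let ?M = "edge_indicators n P p q"
  let ?V = "{1..n} - {i, j}"
  let ?pr = "edge_prob P p q"
  define r where "r k = ?pr (edge i k) * ?pr (edge j k)" for k
  let ?b = "\<lambda>i. real (card (block P i))"
  have neq: "i \<noteq> j" using ij same_block_refl[OF P] by auto
  have pr: "?pr e \<in> {0..1}" for e using p q by (auto simp: edge_prob_def split: prod.splits)
  have r0: "0 \<le> r k" for k using pr by (auto simp: r_def)
  have five: "measure_pmf.prob ?M {f. f (edge i j) \<and> f (edge i k) \<and> f (edge j k) \<and>
      f (edge i l) \<and> f (edge j l)} = q * r k * r l"
    if kl: "k \<in> ?V" "l \<in> ?V - {k}" for k l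
  proof -
    let ?E = "{edge i j, edge i k, edge j k, edge i l, edge j l}"
    have "measure_pmf.prob ?M {f. \<forall>e\<in>?E. f e} = (\<Prod>e\<in>?E. ?pr e)"
      unfolding edge_indicators_def using kl ij neq pr
      by (intro prob_all_True) (auto simp: edge_in_pairs)
    also have "\<dots> = ?pr (edge i j) * r k * r l"
      using kl neq by (simp add: edge_eq_iff r_def mult_ac)
    also have "?pr (edge i j) = q" using ij by (simp add: edge_prob_edge)
    finally show ?thesis by simp
  qed
  have "measure_pmf.prob ?M {f. f (edge i j) \<and> 2 \<le> card {k \<in> ?V. f (edge i k) \<and> f (edge j k)}} \<le>
      measure_pmf.prob ?M (\<Union>k\<in>?V. \<Union>l\<in>?V - {k}. {f. f (edge i j) \<and> f (edge i k) \<and> f (edge j k) \<and>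
        f (edge i l) \<and> f (edge j l)})"
  proof (intro measure_pmf.finite_measure_mono subsetI)
    fix f assume "f \<in> {f. f (edge i j) \<and> 2 \<le> card {k \<in> ?V. f (edge i k) \<and> f (edge j k)}}"
    then have f: "f (edge i j)" "2 \<le> card {k \<in> ?V. f (edge i k) \<and> f (edge j k)}" by auto
    obtain k l where "k \<in> {k \<in> ?V. f (edge i k) \<and> f (edge j k)}"
      "l \<in> {k \<in> ?V. f (edge i k) \<and> f (edge j k)}" "k \<noteq> l"
      using f(2) by (meson card_2_iff' obtain_subset_with_card_n subsetD)
    then show "f \<in> (\<Union>k\<in>?V. \<Union>l\<in>?V - {k}. {f. f (edge i j) \<and> f (edge i k) \<and> f (edge j k) \<and>
        f (edge i l) \<and> f (edge j l)})"
      using f(1) by blast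
  qed simp
  also have "\<dots> \<le> (\<Sum>k\<in>?V. measure_pmf.prob ?M (\<Union>l\<in>?V - {k}. {f. f (edge i j) \<and> f (edge i k) \<and>
      f (edge j k) \<and> f (edge i l) \<and> f (edge j l)}))"
    by (intro prob_UN_le) simp
  also have "\<dots> \<le> (\<Sum>k\<in>?V. \<Sum>l\<in>?V - {k}. q * r k * r l)"
    by (intro sum_mono order.trans[OF prob_UN_le] eq_refl sum.cong five) auto
  also have "\<dots> \<le> (\<Sum>k\<in>{1..n}. \<Sum>l\<in>{1..n}. q * r k * r l)"
    using q r0 by (intro sum_mono2 order.trans[OF sum_mono[OF sum_mono2] sum_mono2])
      (auto intro!: sum_nonneg)
  also have "\<dots> = q * (\<Sum>k\<in>{1..n}. r k) ^ 2"
    by (simp add: power2_eq_square sum_distrib_left sum_distrib_right mult_ac)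
  also have "\<dots> \<le> q * (real n * q ^ 2 + p * q * ?b i + p * q * ?b j) ^ 2"
  proof (intro mult_left_mono power_mono)
    \<comment> \<open>A vertex in the block of \<open>i\<close> reaches \<open>i\<close> with probability \<open>p\<close> but \<open>j\<close> only with probability \<open>q\<close>.\<close>
    have "r k \<le> q ^ 2 + p * q * indicator (block P i) k + p * q * indicator (block P j) k"
      if "k \<in> {1..n}" for k
    proof -
      have "same_block P i k \<longleftrightarrow> k \<in> block P i" "same_block P j k \<longleftrightarrow> k \<in> block P j"
        using same_block_iff[OF P] ij by auto
      moreover have "\<not> (same_block P i k \<and> same_block P j k)"
        using ij same_block_trans[OF P] same_block_sym by blast
      ultimately show ?thesis
        using p q by (auto simp: r_def edge_prob_edge power2_eq_square indicator_def)
    qed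
    then have "(\<Sum>k\<in>{1..n}. r k) \<le>
        (\<Sum>k\<in>{1..n}. q ^ 2 + p * q * indicator (block P i) k + p * q * indicator (block P j) k)"
      by (rule sum_mono)
    also have "\<dots> = real n * q ^ 2 + p * q * ?b i + p * q * ?b j"
    proof -
      have "(\<Sum>k\<in>{1..n}. indicator (block P i) k) = ?b i" if "i \<in> {1..n}" for i
        using block_subset[OF P that] by (simp add: indicator_def sum.If_cases Int_absorb1)
      then show ?thesis using ij by (simp add: sum.distrib sum_distrib_left[symmetric])
    qed
    finally show "(\<Sum>k\<in>{1..n}. r k) \<le> real n * q ^ 2 + p * q * ?b i + p * q * ?b j" .
  qed (use q r0 in \<open>auto intro: sum_nonneg\<close>)
  also have "\<dots> \<le> q * (3 * ((real n * q ^ 2) ^ 2 + (p * q * ?b i) ^ 2 + (p * q * ?b j) ^ 2))"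
    using q by (intro mult_left_mono square_sum3_le) auto
  also have "\<dots> = 3 * real n ^ 2 * q ^ 5 + 3 * p ^ 2 * q ^ 3 * (?b i ^ 2 + ?b j ^ 2)"
    by (simp add: algebra_simps eval_nat_numeral)
  finally show ?thesis .
qed

section \<open>Failure given the partition\<close>

text \<open>The first two terms bound the expected number of edges between blocks that have two common
  neighbors, the last one the expected number of pairs inside a block with too few of them. The
  parameter \<open>\<beta>\<close> is a common bound on the probability of too few, over all blocks of more than one
  vertex; for a partition into singletons it may be \<open>0\<close>.\<close>

lemma conditional_failure:
  assumes P: "partition_on {1..n} P" and p: "p \<in> {0..1}" and q: "q \<in> {0..1}"
    and \<beta>: "\<And>i. i \<in> {1..n} \<Longrightarrow> 1 < card (block P i) \<Longrightarrow>
      exp 3 * (1 + real (card (block P i)) * p ^ 2) * exp (- (real (card (block P i)) * p ^ 2)) \<le> \<beta>"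
  shows "measure_pmf.prob (ppm_given n P p q) {G. diamond_percolation n G \<noteq> P} \<le>
    3 * real n ^ 4 * q ^ 5
      + 6 * real n * p ^ 2 * q ^ 3 * (\<Sum>i\<in>{1..n}. real (card (block P i)) ^ 2)
      + real (num_intra n P) * \<beta>"
proof -
  let ?M = "edge_indicators n P p q"
  let ?b = "\<lambda>i. real (card (block P i)) ^ 2"
  define A where "A = (\<lambda>(i, j). {f. f (edge i j) \<and>
    2 \<le> card {k \<in> {1..n} - {i, j}. f (edge i k) \<and> f (edge j k)}})"
  define B where "B = (\<lambda>(i, j). {f. card {k \<in> block P i - {i, j}. f (edge i k) \<and> f (edge j k)} < 2})"
  let ?I = "{(i, j) \<in> {1..n} \<times> {1..n}. \<not> same_block P i j}"
  let ?J = "{(i, j) \<in> pairs n. same_block P i j}"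
  have finI: "finite ?I" by (rule finite_subset[of _ "{1..n} \<times> {1..n}"]) auto
  have finJ: "finite ?J" by (rule finite_subset[of _ "pairs n"]) auto
  have recovered: "diamond_percolation n (graph_of n f) = P"
    if f: "f \<notin> (\<Union>e\<in>?I. A e) \<union> (\<Union>e\<in>?J. B e)" for f
  proof (rule diamond_percolation_eqI[OF P])
    show "\<exists>i j. (i, j) \<in> pairs n \<and> e = {i, j}" if "e \<in> graph_of n f" for e
      using that by (auto simp: graph_of_def)
    show "card (common_neighbors n (graph_of n f) i j) < 2"
      if ij: "i \<in> {1..n}" "j \<in> {1..n}" "\<not> same_block P i j" "{i, j} \<in> graph_of n f" for i j
    proof -
      have "f \<notin> A (i, j)" using f ij by blast
      then show ?thesis
        using ij(4) unfolding common_neighbors_graph_of[OF ij(1,2)] in_graph_of A_def by simp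
    qed
    show "2 \<le> card (common_neighbors n (graph_of n f) i j \<inter> block P i)"
      if ij: "i \<in> {1..n}" "j \<in> {1..n}" "i \<noteq> j" "same_block P i j" for i j
    proof -
      have bl: "block P j = block P i"
        using block_eq[OF P block_in_partition(1)[OF P ij(1)]] ij same_block_iff[OF P ij(1)] by blast
      have "2 \<le> card {k \<in> block P i - {i, j}. f (edge i k) \<and> f (edge j k)}"
      proof (cases "i < j")
        case True
        then have "(i, j) \<in> ?J" using ij by (auto simp: pairs_def)
        then have "f \<notin> B (i, j)" using f by blast
        then show ?thesis by (simp add: B_def)
      next
        case False
        then have "(j, i) \<in> ?J" using ij same_block_sym by (auto simp: pairs_def)
        then have "f \<notin> B (j, i)" using f by blast
        moreover have "{k \<in> block P j - {j, i}. f (edge j k) \<and> f (edge i k)} =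
            {k \<in> block P i - {i, j}. f (edge i k) \<and> f (edge j k)}"
          unfolding bl by blast
        ultimately show ?thesis by (simp add: B_def)
      qed
      also have "{k \<in> block P i - {i, j}. f (edge i k) \<and> f (edge j k)} =
          common_neighbors n (graph_of n f) i j \<inter> block P i"
        using block_subset[OF P ij(1)] unfolding common_neighbors_graph_of[OF ij(1,2)] by blast
      finally show ?thesis .
    qed
  qed
  have sumA: "(\<Sum>e\<in>?I. measure_pmf.prob ?M (A e)) \<le>
      3 * real n ^ 4 * q ^ 5 + 6 * real n * p ^ 2 * q ^ 3 * (\<Sum>i\<in>{1..n}. ?b i)"
  proof -
    let ?h = "\<lambda>(i, j). 3 * real n ^ 2 * q ^ 5 + 3 * p ^ 2 * q ^ 3 * (?b i + ?b j)"
    have "(\<Sum>e\<in>?I. measure_pmf.prob ?M (A e)) \<le> (\<Sum>e\<in>?I. ?h e)"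
    proof (rule sum_mono)
      fix e assume "e \<in> ?I"
      then show "measure_pmf.prob ?M (A e) \<le> ?h e"
        using inter_edge_with_two_common_neighbors[OF P p q] by (auto simp: A_def)
    qed
    also have "\<dots> \<le> (\<Sum>e\<in>{1..n} \<times> {1..n}. ?h e)"
      using p q by (intro sum_mono2) auto
    also have "\<dots> = (\<Sum>i\<in>{1..n}. \<Sum>j\<in>{1..n}. ?h (i, j))"
      by (simp add: sum.cartesian_product)
    also have "\<dots> = 3 * real n ^ 4 * q ^ 5 + 6 * real n * p ^ 2 * q ^ 3 * (\<Sum>i\<in>{1..n}. ?b i)"
      by (simp add: sum.distrib sum_distrib_left[symmetric] distrib_left eval_nat_numeral)
    finally show ?thesis .
  qed
  have sumB: "(\<Sum>e\<in>?J. measure_pmf.prob ?M (B e)) \<le> real (num_intra n P) * \<beta>"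
  proof -
    have "(\<Sum>e\<in>?J. measure_pmf.prob ?M (B e)) \<le> (\<Sum>e\<in>?J. \<beta>)"
    proof (rule sum_mono)
      fix e assume "e \<in> ?J"
      then obtain i j where e: "e = (i, j)" and ij: "i \<in> {1..n}" "j \<in> {1..n}" "i \<noteq> j" "same_block P i j"
        by (auto simp: pairs_def)
      have j: "j \<in> block P i" using ij same_block_iff[OF P ij(1)] by simp
      have "finite (block P i)" using block_subset[OF P ij(1)] finite_subset by blast
      moreover have "{i, j} \<subseteq> block P i" using j block_in_partition[OF P ij(1)] by auto
      ultimately have "card {i, j} \<le> card (block P i)" by (intro card_mono)
      then have "1 < card (block P i)" using ij(3) by simp
      then show "measure_pmf.prob ?M (B e) \<le> \<beta>"
        using few_common_neighbors_in_block[OF P p ij(1) j ij(3), of q] \<beta>[OF ij(1)]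
        unfolding e B_def by simp
    qed
    also have "\<dots> = real (num_intra n P) * \<beta>" by (simp add: num_intra_def)
    finally show ?thesis .
  qed
  have "measure_pmf.prob (ppm_given n P p q) {G. diamond_percolation n G \<noteq> P} =
      measure_pmf.prob ?M {f. diamond_percolation n (graph_of n f) \<noteq> P}"
    by (simp add: ppm_given_eq vimage_def)
  also have "\<dots> \<le> measure_pmf.prob ?M ((\<Union>e\<in>?I. A e) \<union> (\<Union>e\<in>?J. B e))"
    using recovered by (intro measure_pmf.finite_measure_mono) auto
  also have "\<dots> \<le> measure_pmf.prob ?M (\<Union>e\<in>?I. A e) + measure_pmf.prob ?M (\<Union>e\<in>?J. B e)"
    by (intro measure_Un_le) auto
  also have "\<dots> \<le> (\<Sum>e\<in>?I. measure_pmf.prob ?M (A e)) + (\<Sum>e\<in>?J. measure_pmf.prob ?M (B e))"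
    by (intro add_mono prob_UN_le finI finJ)
  finally show ?thesis using sumA sumB by simp
qed

section \<open>Averaging over the partition\<close>

lemma prob_bind_pmf:
  "measure_pmf.prob (bind_pmf M N) X = measure_pmf.expectation M (\<lambda>x. measure_pmf.prob (N x) X)"
proof -
  have "integrable M (\<lambda>x. measure_pmf.prob (N x) X)"
    by (rule measure_pmf.integrable_const_bound[where B = 1]) auto
  then have "(\<integral>\<^sup>+x. ennreal (measure_pmf.prob (N x) X) \<partial>M) =
      ennreal (measure_pmf.expectation M (\<lambda>x. measure_pmf.prob (N x) X))"
    by (intro nn_integral_eq_integral) auto
  then have "emeasure (bind_pmf M N) X = ennreal (measure_pmf.expectation M (\<lambda>x. measure_pmf.prob (N x) X))"
    unfolding emeasure_bind_pmf by (simp only: measure_pmf.emeasure_eq_measure)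
  then show ?thesis
    by (simp add: measure_pmf.emeasure_eq_measure integral_nonneg_AE)
qed

lemma expectation_block_size_square:
  assumes "finite (set_pmf T)" "0 < n"
  shows "measure_pmf.expectation (block_size_pmf n T) (\<lambda>k. real k ^ 2) =
    measure_pmf.expectation T (\<lambda>P. \<Sum>i\<in>{1..n}. real (card (block P i)) ^ 2) / real n"
proof -
  have U: "set_pmf (pmf_of_set {1..n}) = {1..n}" using assms by (intro set_pmf_of_set) auto
  have eq: "block_size_pmf n T =
      bind_pmf T (\<lambda>P. map_pmf (\<lambda>i. card (block P i)) (pmf_of_set {1..n}))"
    by (simp add: block_size_pmf_def pair_pmf_def map_pmf_def bind_assoc_pmf bind_return_pmf)
  have "measure_pmf.expectation (block_size_pmf n T) (\<lambda>k. real k ^ 2) =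
      (\<Sum>P\<in>set_pmf T. pmf T P * ((\<Sum>i\<in>{1..n}. real (card (block P i)) ^ 2) / real n))"
    unfolding eq using assms U
    by (subst pmf_expectation_bind[of "set_pmf T"]) (auto simp: integral_pmf_of_set)
  also have "\<dots> = measure_pmf.expectation T (\<lambda>P. (\<Sum>i\<in>{1..n}. real (card (block P i)) ^ 2) / real n)"
    using assms by (subst integral_measure_pmf[of "set_pmf T"]) auto
  finally show ?thesis by simp
qed

text \<open>On a partition where \<open>\<beta>\<close> does not bound the tails, it suffices that the number of pairs inside blocks
  times \<open>\<beta>\<close> is at least \<open>1\<close>, since then the bound is at least as large as any probability. This
  alternative makes one expression, the expected number of pairs times \<open>\<beta>\<close>, serve both for the
  union bound and for Markov's inequality.\<close>

lemma failure_bound: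
  assumes T: "\<And>P. P \<in> set_pmf T \<Longrightarrow> partition_on {1..n} P" and n: "0 < n"
    and p: "p \<in> {0..1}" and q: "q \<in> {0..1}" and \<beta>0: "0 \<le> \<beta>"
    and \<beta>: "\<And>P. P \<in> set_pmf T \<Longrightarrow> P \<notin> Bad \<Longrightarrow>
      1 \<le> real (num_intra n P) * \<beta> \<or>
      (\<forall>i\<in>{1..n}. 1 < card (block P i) \<longrightarrow>
        exp 3 * (1 + real (card (block P i)) * p ^ 2) * exp (- (real (card (block P i)) * p ^ 2)) \<le> \<beta>)"
  shows "1 - measure_pmf.prob (ppm n T p q) {(P, G). rho n (diamond_percolation n G) P = 1} \<le>
    measure_pmf.prob T Bad + 3 * (real n ^ 4 * q ^ 5)
      + 6 * (real n ^ 2 * measure_pmf.expectation (block_size_pmf n T) (\<lambda>k. real k ^ 2) * q ^ 3 * p ^ 2)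
      + measure_pmf.expectation T (\<lambda>P. real (num_intra n P)) * \<beta>"
proof -
  let ?S = "\<lambda>P. \<Sum>i\<in>{1..n}. real (card (block P i)) ^ 2"
  let ?fail = "\<lambda>P. measure_pmf.prob (ppm_given n P p q) {G. rho n (diamond_percolation n G) P \<noteq> 1}"
  let ?c = "3 * real n ^ 4 * q ^ 5"
  let ?d = "6 * real n * p ^ 2 * q ^ 3"
  have fin: "finite (set_pmf T)"
    using T finitely_many_partition_on[of "{1..n}"]
    by (auto intro: finite_subset[of _ "{P. partition_on {1..n} P}"])
  note int = integrable_measure_pmf_finite[OF fin]
  have c0: "0 \<le> ?c" and d0: "0 \<le> ?d * ?S P" for P
    using p q by (auto intro!: mult_nonneg_nonneg sum_nonneg)
  have pointwise: "?fail P \<le> indicator Bad P + ?c + ?d * ?S P + real (num_intra n P) * \<beta>"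
    if P: "P \<in> set_pmf T" for P
  proof (cases "P \<in> Bad \<or> 1 \<le> real (num_intra n P) * \<beta>")
    case True
    have "?fail P \<le> 1" by simp
    also have "1 \<le> indicator Bad P + real (num_intra n P) * \<beta>"
      using True \<beta>0 by (auto simp: indicator_def)
    finally show ?thesis using c0 d0[of P] by linarith
  next
    case False
    have "?fail P \<le> measure_pmf.prob (ppm_given n P p q) {G. diamond_percolation n G \<noteq> P}"
      using rho_self by (intro measure_pmf.finite_measure_mono) auto
    also have "\<dots> \<le> ?c + ?d * ?S P + real (num_intra n P) * \<beta>"
      using \<beta>[OF P] False by (intro conditional_failure T P p q) auto
    finally show ?thesis using False by simp
  qed
  have "1 - measure_pmf.prob (ppm n T p q) {(P, G). rho n (diamond_percolation n G) P = 1} =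
      measure_pmf.prob (ppm n T p q) {(P, G). rho n (diamond_percolation n G) P \<noteq> 1}"
    by (subst measure_pmf.prob_compl[symmetric]) (auto intro!: arg_cong[where f = "measure_pmf.prob _"])
  also have "\<dots> = measure_pmf.expectation T ?fail"
    by (simp add: ppm_def prob_bind_pmf vimage_def)
  also have "\<dots> \<le> measure_pmf.expectation T
      (\<lambda>P. indicator Bad P + ?c + ?d * ?S P + real (num_intra n P) * \<beta>)"
    using pointwise by (intro integral_mono_AE int) (auto simp: AE_measure_pmf_iff)
  also have "\<dots> = measure_pmf.prob T Bad + ?c + ?d * measure_pmf.expectation T ?S
      + measure_pmf.expectation T (\<lambda>P. real (num_intra n P)) * \<beta>"
    by (simp add: Bochner_Integration.integral_add int del: of_nat_sum)
  also have "measure_pmf.expectation T ?S =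
      real n * measure_pmf.expectation (block_size_pmf n T) (\<lambda>k. real k ^ 2)"
    using expectation_block_size_square[OF fin n] n by simp
  finally show ?thesis by (simp add: power2_eq_square mult_ac)
qed

section \<open>Exact recovery\<close>

lemma one_plus_times_exp_antimono:
  fixes x y :: real
  assumes "0 \<le> x" "x \<le> y"
  shows "(1 + y) * exp (- y) \<le> (1 + x) * exp (- x)"
proof -
  have "1 + y \<le> (1 + x) * (1 + (y - x))"
    using assms mult_nonneg_nonneg[of x "y - x"] by (simp add: algebra_simps)
  also have "\<dots> \<le> (1 + x) * exp (y - x)"
    using assms by (intro mult_left_mono exp_ge_add_one_self) auto
  finally have "(1 + y) * exp (- y) \<le> ((1 + x) * exp (y - x)) * exp (- y)"
    by (rule mult_right_mono) simp
  then show ?thesis by (simp add: mult.assoc exp_add[symmetric])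
qed

text \<open>The pairs that contain one fixed vertex of the block already suffice for Markov's inequality.\<close>

lemma num_intra_ge:
  assumes P: "partition_on {1..n} P" and i: "i \<in> {1..n}"
  shows "card (block P i) - 1 \<le> num_intra n P"
proof -
  have sub: "block P i \<subseteq> {1..n}" using block_subset[OF P i] .
  have fin: "finite (block P i)" using sub finite_subset by blast
  have "card (block P i) - 1 = card (block P i - {i})"
    using block_in_partition[OF P i] fin by simp
  also have "\<dots> \<le> num_intra n P"
    unfolding num_intra_def
  proof (rule card_inj_on_le)
    show "inj_on (edge i) (block P i - {i})"
      by (auto simp: inj_on_def edge_eq_iff)
    show "finite {(i, j) \<in> pairs n. same_block P i j}"
      by (rule finite_subset[of _ "pairs n"]) auto
    show "edge i ` (block P i - {i}) \<subseteq> {(i, j) \<in> pairs n. same_block P i j}"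
    proof
      fix e assume "e \<in> edge i ` (block P i - {i})"
      then obtain j where j: "j \<in> block P i" "j \<noteq> i" "e = edge i j" by auto
      have "e \<in> pairs n" using j sub i by (auto simp: edge_in_pairs)
      moreover have "same_block P i j" using j same_block_iff[OF P i] by simp
      ultimately show "e \<in> {(i, j) \<in> pairs n. same_block P i j}"
        using j(3) same_block_sym[of P i j] by (auto simp: edge_def min_def max_def)
    qed
  qed
  finally show ?thesis .
qed

text \<open>The last summand covers both regimes of \<open>m\<close>. If \<open>m > exp 1\<close>, then \<open>L = ln m \<ge> 1\<close> and
  \<open>1 + x = 1 + L + ln L + w \<le> L (3 + w)\<close>, so the division by \<open>L\<close> that \<open>ln (ln m)\<close> supplies in
  \<open>m exp (- x) = exp (- w) / L\<close> absorbs the factor \<open>1 + x\<close>. If \<open>m \<le> exp 1\<close>, Markov's inequality is used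
  with \<open>\<beta> = 1 / (s - 1)\<close>.\<close>

lemma large_blocks_failure_bound:
  fixes T :: "nat set set pmf" and n :: nat and s w p q :: real
  defines "m \<equiv> measure_pmf.expectation T (\<lambda>P. real (num_intra n P))"
  assumes T: "\<And>P. P \<in> set_pmf T \<Longrightarrow> partition_on {1..n} P" and n: "0 < n"
    and p: "p \<in> {0..1}" and q: "q \<in> {0..1}"
    and s: "1 < s" and w: "0 \<le> w" and m: "1 < m"
    and p_eq: "p = sqrt ((ln m + ln (ln m) + w) / s)"
  shows "1 - measure_pmf.prob (ppm n T p q) {(P, G). rho n (diamond_percolation n G) P = 1} \<le>
    measure_pmf.prob T {P. \<exists>i\<in>{1..n}. 1 < card (block P i) \<and> real (card (block P i)) < s}
      + 3 * (real n ^ 4 * q ^ 5)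
      + 6 * (real n ^ 2 * measure_pmf.expectation (block_size_pmf n T) (\<lambda>k. real k ^ 2) * q ^ 3 * p ^ 2)
      + (exp 3 * ((3 + w) * exp (- w)) + exp 1 / (s - 1))"
proof -
  let ?Bad = "{P. \<exists>i\<in>{1..n}. 1 < card (block P i) \<and> real (card (block P i)) < s}"
  let ?t = "\<lambda>x. exp 3 * (1 + x) * exp (- x) :: real"
  define x where "x = ln m + ln (ln m) + w"
  \<comment> \<open>For a negative radicand \<^const>\<open>sqrt\<close> would be negative, so \<open>p \<ge> 0\<close> yields \<open>x \<ge> 0\<close>.\<close>
  have "0 \<le> x / s" using p p_eq by (simp add: x_def)
  then have p2: "p ^ 2 = x / s" and x0: "0 \<le> x"
    using s by (simp_all add: p_eq x_def zero_le_divide_iff)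
  define \<beta> where "\<beta> = (if m \<le> exp 1 then 1 / (s - 1) else ?t x)"
  have \<beta>0: "0 \<le> \<beta>" using s x0 by (simp add: \<beta>_def)
  have m\<beta>: "m * \<beta> \<le> exp 3 * ((3 + w) * exp (- w)) + exp 1 / (s - 1)"
  proof (cases "m \<le> exp 1")
    case True
    have "m * \<beta> \<le> exp 1 / (s - 1)"
      using True s by (simp add: \<beta>_def divide_right_mono)
    then show ?thesis using w by (simp add: add_increasing)
  next
    case False
    define L where "L = ln m"
    have L: "1 \<le> L" using False m ln_mono[of "exp 1" m] by (simp add: L_def)
    have "exp x = m * L * exp w"
      using m L by (simp add: x_def L_def exp_add)
    then have ex: "m * exp (- x) = exp (- w) / L"
      using m L by (simp add: exp_minus field_simps)
    have "1 + x \<le> L * (3 + w)"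
    proof -
      have "ln L \<le> L" using L ln_less_self[of L] by linarith
      moreover have "w \<le> L * w" using L w by (simp add: mult_le_cancel_right1)
      ultimately show ?thesis using L unfolding x_def L_def[symmetric] by (simp add: algebra_simps)
    qed
    then have "(1 + x) / L \<le> 3 + w" using L by (simp add: field_simps)
    then have "exp 3 * (exp (- w) * ((1 + x) / L)) \<le> exp 3 * (exp (- w) * (3 + w))"
      by (intro mult_left_mono) auto
    moreover have "m * \<beta> = exp 3 * (1 + x) * (m * exp (- x))"
      using False by (simp add: \<beta>_def)
    ultimately have "m * \<beta> \<le> exp 3 * ((3 + w) * exp (- w))"
      unfolding ex by (simp add: mult_ac)
    moreover have "0 \<le> exp 1 / (s - 1)" using s by simp
    ultimately show ?thesis by linarith
  qed
  have blocks: "1 \<le> real (num_intra n P) * \<beta> \<or>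
      (\<forall>i\<in>{1..n}. 1 < card (block P i) \<longrightarrow> ?t (real (card (block P i)) * p ^ 2) \<le> \<beta>)"
    if P: "P \<in> set_pmf T" "P \<notin> ?Bad" for P
  proof (cases "m \<le> exp 1")
    case True
    show ?thesis
    proof (cases "\<exists>i\<in>{1..n}. 1 < card (block P i)")
      case True
      then obtain i where i: "i \<in> {1..n}" "1 < card (block P i)" by blast
      then have "s - 1 \<le> real (card (block P i)) - 1" using P by auto
      also have "\<dots> = real (card (block P i) - 1)" using i by simp
      also have "\<dots> \<le> real (num_intra n P)"
        using num_intra_ge[OF T[OF P(1)] i(1)] by simp
      finally show ?thesis using s \<open>m \<le> exp 1\<close> by (simp add: \<beta>_def)
    qed blast
  next
    case False
    have "?t (real (card (block P i)) * p ^ 2) \<le> \<beta>"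
      if "i \<in> {1..n}" "1 < card (block P i)" for i
    proof -
      have "s \<le> real (card (block P i))" using that P by force
      then have "s * (x / s) \<le> real (card (block P i)) * (x / s)"
        using x0 s by (intro mult_right_mono) auto
      then have "x \<le> real (card (block P i)) * p ^ 2" using s by (simp add: p2)
      from one_plus_times_exp_antimono[OF x0 this] show ?thesis
        using False by (simp add: \<beta>_def mult.assoc)
    qed
    then show ?thesis by blast
  qed
  show ?thesis
    using failure_bound[of T n p q \<beta> ?Bad, OF T n p q \<beta>0 blocks] m\<beta>
    unfolding m_def by linarith
qed

theorem theorem4p2:
  fixes T :: "nat \<Rightarrow> nat set set pmf"
    and p q s \<omega> :: "nat \<Rightarrow> real"
  assumes T: "\<And>n. \<forall>P\<in>set_pmf (T n). partition_on {1..n} P"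
    and p: "\<And>n. p n \<in> {0..1}"
    and q: "\<And>n. q n \<in> {0..1}"
    and i1: "(\<lambda>n. real n ^ 2 * measure_pmf.expectation (block_size_pmf n (T n)) (\<lambda>k. real k ^ 2)
                    * q n ^ 3 * p n ^ 2) \<in> o(\<lambda>_. 1)"
    and i2: "q \<in> o(\<lambda>n. real n powr (- 4 / 5))"
    and ii1: "filterlim s at_top sequentially"
    and ii2: "(\<lambda>n. measure_pmf.prob (T n)
                {P. \<exists>i\<in>{1..n}. 1 < card (block P i) \<and> real (card (block P i)) < s n})
                \<longlonglongrightarrow> 0"
    and iii1: "filterlim \<omega> at_top sequentially"
    and iii2: "\<forall>\<^sub>F n in sequentially.
                 measure_pmf.expectation (T n) (\<lambda>P. real (num_intra n P)) > 1 \<and>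
                 p n = sqrt ((ln (measure_pmf.expectation (T n) (\<lambda>P. real (num_intra n P)))
                              + ln (ln (measure_pmf.expectation (T n) (\<lambda>P. real (num_intra n P))))
                              + \<omega> n) / s n)"
  shows "(\<lambda>n. measure_pmf.prob (ppm n (T n) (p n) (q n))
            {(P, G). rho n (diamond_percolation n G) P = 1}) \<longlonglongrightarrow> 1"
proof -
  let ?good = "\<lambda>n. measure_pmf.prob (ppm n (T n) (p n) (q n))
            {(P, G). rho n (diamond_percolation n G) P = 1}"
  let ?bad = "\<lambda>n. measure_pmf.prob (T n)
                {P. \<exists>i\<in>{1..n}. 1 < card (block P i) \<and> real (card (block P i)) < s n}"
  let ?A = "\<lambda>n. real n ^ 4 * q n ^ 5"
  let ?B = "\<lambda>n. real n ^ 2 * measure_pmf.expectation (block_size_pmf n (T n)) (\<lambda>k. real k ^ 2)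
                    * q n ^ 3 * p n ^ 2"
  let ?C = "\<lambda>n. exp 3 * ((3 + \<omega> n) * exp (- \<omega> n)) + exp 1 / (s n - 1)"
  have bound: "\<forall>\<^sub>F n in sequentially. 1 - ?good n \<le> ?bad n + 3 * ?A n + 6 * ?B n + ?C n"
  proof -
    have "\<forall>\<^sub>F n in sequentially. 1 < s n" "\<forall>\<^sub>F n in sequentially. 0 \<le> \<omega> n"
      using ii1 iii1 unfolding filterlim_at_top_dense[of s] filterlim_at_top[of \<omega>] by blast+
    with iii2 eventually_gt_at_top[of "0 :: nat"] show ?thesis
    proof eventually_elim
      case (elim n)
      then show ?case
        using T by (intro large_blocks_failure_bound p q) blast+
    qed
  qed
  have A: "?A \<longlonglongrightarrow> 0"
  proof -
    have "(\<lambda>n. q n / real n powr (- 4 / 5)) \<longlonglongrightarrow> 0"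
      using i2 by (rule smalloD_tendsto)
    then have "(\<lambda>n. (q n / real n powr (- 4 / 5)) ^ 5) \<longlonglongrightarrow> 0 ^ 5"
      by (rule tendsto_power)
    moreover have "\<forall>\<^sub>F n in sequentially. (q n / real n powr (- 4 / 5)) ^ 5 = ?A n"
      using eventually_gt_at_top[of "0 :: nat"]
    proof eventually_elim
      case (elim n)
      have "(real n powr (4 / 5)) ^ 5 = real n powr real 4"
        using elim powr_power[where z = "real n" and n = 5 and u = "4 / 5"] by simp
      also have "\<dots> = real n ^ 4" using elim by (intro powr_realpow) simp
      finally have pow: "(real n powr (4 / 5)) ^ 5 = real n ^ 4" .
      have "real n powr (- 4 / 5) = inverse (real n powr (4 / 5))"
        unfolding powr_minus[symmetric] by simp
      then have "(q n / real n powr (- 4 / 5)) ^ 5 = q n ^ 5 * (real n powr (4 / 5)) ^ 5"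
        by (simp only: divide_inverse inverse_inverse_eq power_mult_distrib)
      then show ?case by (simp only: pow mult.commute)
    qed
    ultimately have "?A \<longlonglongrightarrow> 0 ^ 5" by (rule Lim_transform_eventually)
    then show ?thesis by simp
  qed
  have B: "?B \<longlonglongrightarrow> 0"
    using smalloD_tendsto[OF i1] by simp
  have C: "?C \<longlonglongrightarrow> 0"
  proof -
    have "((\<lambda>x :: real. exp 3 * (3 * (x ^ 0 / exp x) + x ^ 1 / exp x)) \<longlongrightarrow> exp 3 * (3 * 0 + 0)) at_top"
      by (intro tendsto_intros tendsto_power_div_exp_0)
    then have "((\<lambda>x :: real. exp 3 * ((3 + x) * exp (- x))) \<longlongrightarrow> 0) at_top"
      by (simp add: exp_minus field_simps)
    then have "(\<lambda>n. exp 3 * ((3 + \<omega> n) * exp (- \<omega> n))) \<longlonglongrightarrow> 0"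
      using iii1 by (rule filterlim_compose)
    moreover have "filterlim (\<lambda>n. - 1 + s n) at_top sequentially"
      by (rule filterlim_tendsto_add_at_top[OF tendsto_const ii1])
    then have "(\<lambda>n. exp 1 / (- 1 + s n)) \<longlonglongrightarrow> 0"
      by (intro tendsto_divide_0[OF tendsto_const] filterlim_at_top_imp_at_infinity)
    ultimately show ?thesis
      by (intro tendsto_add_zero) simp_all
  qed
  have upper: "(\<lambda>n. ?bad n + 3 * ?A n + 6 * ?B n + ?C n) \<longlonglongrightarrow> 0"
    by (intro tendsto_add_zero ii2 C tendsto_mult_right_zero A B)
  have "(\<lambda>n. 1 - ?good n) \<longlonglongrightarrow> 0"
    by (rule tendsto_sandwich[OF _ bound tendsto_const upper]) simp
  then have "(\<lambda>n. 1 - (1 - ?good n)) \<longlonglongrightarrow> 1 - 0"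
    by (intro tendsto_diff tendsto_const)
  then show ?thesis by simp
qed

end
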